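(* Let $\mathcal{G}$ be a set of $n$-qubit Pauli strings, $H=\sum_{g\in\mathcal{G}}c_g\,g$ with real coefficients $c_g$, $p$ a Pauli string, and $p_t=e^{iHt}pe^{-iHt}$. Then Krylov complexity is a tight upper bound to the graph complexity: for all such $\mathcal G,H,p$ and all $t\in\mathbb R$, $$\mathsf{G}(p_t)\le\mathsf{K}(p_t),$$ and the bound is tight in the sense that there are choices of $\mathcal{G},H,p,t$ for which $\mathsf{G}(p_t)=\mathsf{K}(p_t)>0$.
   Context: $d=2^n$. A Pauli string is an operator $\sigma_1\otimes\cdots\otimes\sigma_n$ with each $\sigma_i\in\{I,X,Y,Z\}$. The commutator graph of $\mathcal{G}$ is the undirected graph whose vertices are all $4^n$ Pauli strings, with an edge between $p$ and $q$ iff there is $g\in\mathcal{G}$ such that $[g,p]$ is a nonzero scalar multiple of $q$; $C_p$ is the connected component of $p$ and $\ell(p,q)$ the shortest path length between $p$ and $q$. Graph complexity: writing $p_t=\sum_{q\in C_p}c_q(t)\,q$, $\mathsf{G}(p_t)=\sum_{q\in C_p}\ell(p,q)|c_q(t)|^2$. Krylov complexity: operators are regarded as vectors with inner product $\langle\!\langle O|O'\rangle\!\rangle=\frac1d\mathrm{tr}[O^\dagger O']$ (so Pauli strings are orthonormal), and $\mathsf L=[H,\cdot\,]$. Starting from a normalized $O$, the Krylov basis is defined by $O_0=O$, $O_{-1}=0$, $b_0=0$, and recursively $A_m=\mathsf L O_{m-1}-b_{m-1}O_{m-2}$, $b_m=\sqrt{\langle\!\langle A_m|A_m\rangle\!\rangle}$,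 $O_m=b_m^{-1}A_m$, terminating at the first $m$ with $b_m=0$. Expanding $O_t=e^{iHt}Oe^{-iHt}=\sum_m i^m\varphi_m(t)O_m$, the Krylov complexity is $\mathsf{K}(O_t)=\sum_m m|\varphi_m(t)|^2$. Here $O=p$. *)

theory Defs
  imports "HOL-Analysis.Analysis"
begin

section \<open>Operators on qubits\<close>

text \<open>
  The finite type \<open>'n\<close> indexes the qubits, so the number of qubits is \<open>n = CARD('n) \<ge> 1\<close>.
  The computational basis of the \<open>n\<close>-fold tensor power of \<open>\<complex>\<^sup>2\<close> is indexed by the functions
  \<open>'n \<Rightarrow> 2\<close>, and operators are square matrices over this index type, of dimension \<open>d = 2 ^ n\<close>.
\<close>

type_synonym 'n qop = "complex ^ ('n \<Rightarrow> 2) ^ ('n \<Rightarrow> 2)"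

definition cscale :: "complex \<Rightarrow> ('n::finite) qop \<Rightarrow> 'n qop"  (infixr "*\<^sub>C" 75)
  where "z *\<^sub>C A = (\<chi> i j. z * A $ i $ j)"

definition adj :: "('n::finite) qop \<Rightarrow> 'n qop"
  where "adj A = (\<chi> i j. cnj (A $ j $ i))"

definition commutator :: "('n::finite) qop \<Rightarrow> 'n qop \<Rightarrow> 'n qop"
  where "commutator A B = A ** B - B ** A"

definition op_inner :: "('n::finite) qop \<Rightarrow> 'n qop \<Rightarrow> complex"
  where "op_inner A B = trace (adj A ** B) / 2 ^ CARD('n)"

fun matpow :: "('n::finite) qop \<Rightarrow> nat \<Rightarrow> 'n qop"
  where
    "matpow A 0 = mat 1"
  | "matpow A (Suc k) = A ** matpow A k"

definition matexp :: "('n::finite) qop \<Rightarrow> 'n qop"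
  where "matexp A = (\<Sum>k. matpow A k /\<^sub>R fact k)"

definition evolve :: "('n::finite) qop \<Rightarrow> real \<Rightarrow> 'n qop \<Rightarrow> 'n qop"
  where "evolve H t A =
    matexp ((\<i> * of_real t) *\<^sub>C H) ** A ** matexp (- ((\<i> * of_real t) *\<^sub>C H))"

text \<open>
  The coefficients \<open>c\<close> in \<open>A = (\<Sum>i\<in>I. c i *\<^sub>C B i)\<close>, extended by \<open>0\<close> outside \<open>I\<close>. They are unique
  whenever \<open>B\<close> is a linearly independent family on the finite set \<open>I\<close>; below it is always
  orthonormal.
\<close>

definition expansion_coeffs :: "'i set \<Rightarrow> ('i \<Rightarrow> ('n::finite) qop) \<Rightarrow> 'n qop \<Rightarrow> 'i \<Rightarrow> complex"
  where "expansion_coeffs I B A =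
    (THE c. (\<forall>i. i \<notin> I \<longrightarrow> c i = 0) \<and> A = (\<Sum>i\<in>I. c i *\<^sub>C B i))"


section \<open>Pauli strings\<close>

datatype pauli = Pauli_I | Pauli_X | Pauli_Y | Pauli_Z

fun pauli_matrix :: "pauli \<Rightarrow> complex ^ 2 ^ 2"
  where
    "pauli_matrix Pauli_I = vector [vector [1, 0], vector [0, 1]]"
  | "pauli_matrix Pauli_X = vector [vector [0, 1], vector [1, 0]]"
  | "pauli_matrix Pauli_Y = vector [vector [0, - \<i>], vector [\<i>, 0]]"
  | "pauli_matrix Pauli_Z = vector [vector [1, 0], vector [0, - 1]]"

text \<open>
  The tensor product over all qubits \<open>k\<close> of the one-qubit matrices \<open>pauli_matrix (s k)\<close>, written
  in the computational basis.
\<close>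

definition pauli_tensor :: "('n::finite \<Rightarrow> pauli) \<Rightarrow> 'n qop"
  where "pauli_tensor s = (\<chi> x y. \<Prod>k\<in>UNIV. pauli_matrix (s k) $ x k $ y k)"

definition pauli_strings :: "('n::finite) qop set"
  where "pauli_strings = range pauli_tensor"

definition hamiltonian :: "('n::finite) qop set \<Rightarrow> ('n qop \<Rightarrow> real) \<Rightarrow> 'n qop"
  where "hamiltonian G c = (\<Sum>g\<in>G. c g *\<^sub>R g)"


section \<open>Commutator graph and graph complexity\<close>

text \<open>
  For \<open>G \<subseteq> pauli_strings\<close> this relation is symmetric: if \<open>[g, p] \<noteq> 0\<close>, then \<open>g\<close> and \<open>p\<close>
  anticommute and \<open>[g, [g, p]] = 4 p\<close>. Hence it is the edge relation of an undirected graph.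
\<close>

definition commutator_graph :: "('n::finite) qop set \<Rightarrow> ('n qop \<times> 'n qop) set"
  where "commutator_graph G =
    {(p, q). p \<in> pauli_strings \<and> q \<in> pauli_strings \<and>
             (\<exists>g\<in>G. \<exists>z. z \<noteq> 0 \<and> commutator g p = z *\<^sub>C q)}"

definition component :: "('n::finite) qop set \<Rightarrow> 'n qop \<Rightarrow> 'n qop set"
  where "component G p = {q. (p, q) \<in> (commutator_graph G)\<^sup>*}"

definition graph_dist :: "('n::finite) qop set \<Rightarrow> 'n qop \<Rightarrow> 'n qop \<Rightarrow> nat"
  where "graph_dist G p q = (LEAST k. (p, q) \<in> commutator_graph G ^^ k)"

definition graph_complexity :: "('n::finite) qop set \<Rightarrow> 'n qop \<Rightarrow> 'n qop \<Rightarrow> real"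
  where "graph_complexity G p A =
    (\<Sum>q\<in>component G p.
       real (graph_dist G p q) * (cmod (expansion_coeffs (component G p) (\<lambda>q. q) A q))\<^sup>2)"


section \<open>Krylov complexity\<close>

text \<open>
  \<open>krylov_A H V 0\<close> plays no role. In \<open>krylov_A H V (Suc 0)\<close> the term \<open>b\<^sub>0 O\<^sub>-\<^sub>1\<close> is absent because
  \<open>b\<^sub>0 = 0\<close> and \<open>O\<^sub>-\<^sub>1 = 0\<close>. The number \<open>op_inner A A\<close> is always real and nonnegative, so taking
  its real part loses nothing.
\<close>

function (sequential)
      krylov_A :: "('n::finite) qop \<Rightarrow> 'n qop \<Rightarrow> nat \<Rightarrow> 'n qop"
  and krylov_b :: "('n::finite) qop \<Rightarrow> 'n qop \<Rightarrow> nat \<Rightarrow> real"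
  and krylov_O :: "('n::finite) qop \<Rightarrow> 'n qop \<Rightarrow> nat \<Rightarrow> 'n qop"
  where
    "krylov_A H V 0 = 0"
  | "krylov_A H V (Suc 0) = commutator H (krylov_O H V 0)"
  | "krylov_A H V (Suc (Suc m)) =
       commutator H (krylov_O H V (Suc m)) - krylov_b H V (Suc m) *\<^sub>R krylov_O H V m"
  | "krylov_b H V 0 = 0"
  | "krylov_b H V (Suc m) =
       sqrt (Re (op_inner (krylov_A H V (Suc m)) (krylov_A H V (Suc m))))"
  | "krylov_O H V 0 = V"
  | "krylov_O H V (Suc m) = krylov_A H V (Suc m) /\<^sub>R krylov_b H V (Suc m)"
  by pat_completeness auto
termination
  by (relation "Wellfounded.measure (\<lambda>x. case x of Inl (_, _, m) \<Rightarrow> 3 * m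
        | Inr (Inl (_, _, m)) \<Rightarrow> 3 * m + 1 | Inr (Inr (_, _, m)) \<Rightarrow> 3 * m + 2)") auto

text \<open>The Krylov basis consists of the \<open>krylov_O H V m\<close> with \<open>m < krylov_dim H V\<close>.\<close>

definition krylov_dim :: "('n::finite) qop \<Rightarrow> 'n qop \<Rightarrow> nat"
  where "krylov_dim H V = (LEAST m. 1 \<le> m \<and> krylov_b H V m = 0)"

definition krylov_phi :: "('n::finite) qop \<Rightarrow> 'n qop \<Rightarrow> real \<Rightarrow> nat \<Rightarrow> complex"
  where "krylov_phi H V t =
    expansion_coeffs {..<krylov_dim H V} (\<lambda>m. \<i> ^ m *\<^sub>C krylov_O H V m) (evolve H t V)"

definition krylov_complexity :: "('n::finite) qop \<Rightarrow> 'n qop \<Rightarrow> real \<Rightarrow> real"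
  where "krylov_complexity H V t =
    (\<Sum>m<krylov_dim H V. real m * (cmod (krylov_phi H V t m))\<^sup>2)"

end

theory Submission
  imports Defs
begin

text \<open>
  Let \<open>C\<close> be the component of \<open>p\<close>. Each application of \<open>[H, \<cdot>]\<close> moves at most one step
  in the commutator graph, so the Krylov vector \<open>O\<^sub>m\<close> is supported on the Pauli strings at distance
  at most \<open>m\<close> from \<open>p\<close>. Hence the part of \<open>p\<^sub>t\<close> beyond distance \<open>k\<close> depends only on the Krylov
  components with \<open>m > k\<close>, and by Bessel's inequality its weight is at most
  \<open>\<Sum>m>k. |\<phi>\<^sub>m|\<^sup>2\<close>. Summing over \<open>k\<close> yields both complexities. That \<open>p\<^sub>t\<close> lies in the Krylov space
  follows from the Hadamard series \<open>p\<^sub>t = (\<Sum>n. (i t)\<^sup>n / n! [H, \<cdot>]\<^sup>n p)\<close>, as subspaces are closed.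
  Equality holds for \<open>H = Z\<close>, \<open>p = X\<close> on one qubit and \<open>t = \<pi> / 4\<close>, when \<open>p\<^sub>t = - Y\<close>.
\<close>

section \<open>The operator space\<close>

lemma cscale_nth [simp]: "(z *\<^sub>C A) $ i $ j = z * A $ i $ j"
  by (simp add: cscale_def)

text \<open>Through type classes, matrices form a real vector space; this interpretation supplies
  complex spans and subspaces.\<close>

interpretation cvec: vector_space cscale
  by unfold_locales (simp_all add: vec_eq_iff algebra_simps)

lemma scaleR_eq_cscale: "r *\<^sub>R A = of_real r *\<^sub>C A"
  by (simp add: vec_eq_iff) (simp add: scaleR_conv_of_real)

lemma cscale_matrix_mul_left: "(z *\<^sub>C A) ** B = z *\<^sub>C (A ** B)"
  by (simp add: vec_eq_iff matrix_matrix_mult_def sum_distrib_left mult.assoc)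

lemma cscale_matrix_mul_right: "A ** (z *\<^sub>C B) = z *\<^sub>C (A ** B)"
  by (simp add: vec_eq_iff matrix_matrix_mult_def sum_distrib_left mult_ac)

lemma matrix_diff_ldistrib: "(A :: 'n::finite qop) ** (B - C) = A ** B - A ** C"
  by (simp add: vec_eq_iff matrix_matrix_mult_def right_diff_distrib sum_subtractf)

lemma matrix_diff_rdistrib: "((A :: 'n::finite qop) - B) ** C = A ** C - B ** C"
  by (simp add: vec_eq_iff matrix_matrix_mult_def left_diff_distrib sum_subtractf)

lemma matrix_add_rdistrib: "((A :: 'n::finite qop) + B) ** C = A ** C + B ** C"
  by (simp add: vec_eq_iff matrix_matrix_mult_def distrib_right sum.distrib)

lemma matrix_minus_right: "(A :: 'n::finite qop) ** (- B) = - (A ** B)"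
  by (simp add: vec_eq_iff matrix_matrix_mult_def sum_negf)

lemma matrix_sum_left: "(\<Sum>i\<in>I. f i) ** (B :: 'n::finite qop) = (\<Sum>i\<in>I. f i ** B)"
  by (simp add: vec_eq_iff matrix_matrix_mult_def sum_distrib_right sum.swap[of _ I])

lemma matrix_sum_right: "(B :: 'n::finite qop) ** (\<Sum>i\<in>I. f i) = (\<Sum>i\<in>I. B ** f i)"
  by (simp add: vec_eq_iff matrix_matrix_mult_def sum_distrib_left sum.swap[of _ I])

lemma adj_nth [simp]: "adj A $ i $ j = cnj (A $ j $ i)"
  by (simp add: adj_def)

lemma adj_mult: "adj (A ** B) = adj B ** adj A"
  by (simp add: vec_eq_iff matrix_matrix_mult_def mult.commute)

lemma adj_diff: "adj (A - B) = adj A - adj B"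
  by (simp add: vec_eq_iff)

lemma adj_cscale: "adj (z *\<^sub>C A) = cnj z *\<^sub>C adj A"
  by (simp add: vec_eq_iff)

lemma adj_sum: "adj (\<Sum>i\<in>I. f i) = (\<Sum>i\<in>I. adj (f i))"
  by (simp add: vec_eq_iff)

lemma commutator_add: "commutator H (A + B) = commutator H A + commutator H B"
  by (simp add: commutator_def matrix_add_ldistrib matrix_add_rdistrib)

lemma commutator_cscale: "commutator H (z *\<^sub>C A) = z *\<^sub>C commutator H A"
  by (simp add: commutator_def cscale_matrix_mul_left cscale_matrix_mul_right
      cvec.scale_right_diff_distrib)

lemma commutator_cscale_left: "commutator (z *\<^sub>C H) A = z *\<^sub>C commutator H A"
  by (simp add: commutator_def cscale_matrix_mul_left cscale_matrix_mul_right
      cvec.scale_right_diff_distrib)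

lemma commutator_sum_left: "commutator (\<Sum>i\<in>I. f i) A = (\<Sum>i\<in>I. commutator (f i) A)"
  by (simp add: commutator_def matrix_sum_left matrix_sum_right sum_subtractf)

lemma adj_commutator: "adj (commutator H A) = commutator (adj A) (adj H)"
  by (simp add: commutator_def adj_diff adj_mult)

section \<open>The normalized Hilbert-Schmidt inner product\<close>

lemma op_inner_eq_sum:
  "op_inner A B = (\<Sum>i\<in>UNIV. \<Sum>j\<in>UNIV. cnj (A $ i $ j) * B $ i $ j) / 2 ^ CARD('n)"
  for A B :: "'n::finite qop"
  unfolding op_inner_def trace_def matrix_matrix_mult_def
  by (simp add: sum.swap[of "\<lambda>i j. cnj (A $ j $ i) * B $ j $ i"])

lemma op_inner_add_right: "op_inner A (B + C) = op_inner A B + op_inner A C"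
  by (simp add: op_inner_eq_sum algebra_simps sum.distrib add_divide_distrib)

lemma op_inner_diff_right: "op_inner A (B - C) = op_inner A B - op_inner A C"
  by (simp add: op_inner_eq_sum algebra_simps sum_subtractf diff_divide_distrib)

lemma op_inner_cscale_right: "op_inner A (z *\<^sub>C B) = z * op_inner A B"
  by (simp add: op_inner_eq_sum sum_distrib_left mult_ac)

lemma op_inner_zero_right [simp]: "op_inner A 0 = 0"
  by (simp add: op_inner_eq_sum)

lemma op_inner_sum_right: "op_inner A (\<Sum>i\<in>I. f i) = (\<Sum>i\<in>I. op_inner A (f i))"
  by (induction I rule: infinite_finite_induct) (simp_all add: op_inner_add_right)

lemma cnj_op_inner: "cnj (op_inner A B) = op_inner B A"
  by (simp add: op_inner_eq_sum mult.commute)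

lemma op_inner_cscale_left: "op_inner (z *\<^sub>C A) B = cnj z * op_inner A B"
  by (metis cnj_op_inner complex_cnj_mult complex_cnj_cnj op_inner_cscale_right)

lemma op_inner_zero_left [simp]: "op_inner 0 A = 0"
  by (simp add: op_inner_eq_sum)

text \<open>Ties the complex inner product to the type class operation \<open>inner\<close>, so that
  norms, orthogonality and real linear independence can be used.\<close>

lemma Re_op_inner: "Re (op_inner A B) = inner A B / 2 ^ CARD('n)"
  for A B :: "'n::finite qop"
proof -
  have "Re (op_inner A B) = Re ((\<Sum>i\<in>UNIV. \<Sum>j\<in>UNIV. cnj (A $ i $ j) * B $ i $ j) / of_real (2 ^ CARD('n)))"
    by (simp add: op_inner_eq_sum)
  also have "\<dots> = (\<Sum>i\<in>UNIV. \<Sum>j\<in>UNIV. inner (A $ i $ j) (B $ i $ j)) / 2 ^ CARD('n)"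
    by (simp only: Re_divide_of_real) (simp add: inner_complex_def)
  finally show ?thesis
    by (simp add: inner_vec_def)
qed

lemma op_inner_self: "op_inner A A = of_real ((norm A)\<^sup>2 / 2 ^ CARD('n))"
  for A :: "'n::finite qop"
proof (rule complex_eqI)
  show "Re (op_inner A A) = Re (of_real ((norm A)\<^sup>2 / 2 ^ CARD('n)))"
    by (simp only: Re_op_inner power2_norm_eq_inner Re_complex_of_real)
  have "cnj (op_inner A A) = op_inner A A" by (rule cnj_op_inner)
  then show "Im (op_inner A A) = Im (of_real ((norm A)\<^sup>2 / 2 ^ CARD('n)))"
    by (simp add: complex_eq_iff)
qed

text \<open>Cyclicity of the trace moves \<open>H\<close> across the product: for Hermitian
  \<open>H\<close>, the map \<open>commutator H\<close> is self-adjoint.\<close>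

lemma op_inner_commutator: "op_inner A (commutator H B) = op_inner (commutator H A) B"
  if "adj H = H"
proof -
  have "trace (adj A ** (B ** H)) = trace (H ** adj A ** B)"
    by (metis matrix_mul_assoc trace_mul_sym)
  then show ?thesis
    using that
    by (simp add: op_inner_def commutator_def adj_diff adj_mult matrix_diff_ldistrib
        matrix_diff_rdistrib trace_sub matrix_mul_assoc)
qed

text \<open>A complex subspace is also a real one, and real subspaces of a finite-dimensional space
  are closed.\<close>

lemma cvec_closed_subspace:
  assumes "cvec.subspace S"
  shows "closed (S :: 'n::finite qop set)"
  by (rule closed_subspace)
    (use assms in \<open>auto simp: cvec.subspace_def subspace_def scaleR_eq_cscale\<close>)

section \<open>Orthonormal families\<close>

definition orthonormal :: "'i set \<Rightarrow> ('i \<Rightarrow> 'n::finite qop) \<Rightarrow> bool"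
  where "orthonormal I B \<longleftrightarrow>
    finite I \<and> (\<forall>i\<in>I. \<forall>j\<in>I. op_inner (B i) (B j) = (if i = j then 1 else 0))"

lemma orthonormal_subset: "orthonormal I B \<Longrightarrow> J \<subseteq> I \<Longrightarrow> orthonormal J B"
  by (auto simp: orthonormal_def subset_iff intro: finite_subset)

lemma orthonormal_coeff:
  assumes "orthonormal I B" "i \<in> I"
  shows "op_inner (B i) (\<Sum>j\<in>I. c j *\<^sub>C B j) = c i"
proof -
  have "op_inner (B i) (\<Sum>j\<in>I. c j *\<^sub>C B j) = (\<Sum>j\<in>I. if i = j then c j else 0)"
    using assms unfolding op_inner_sum_right orthonormal_def
    by (intro sum.cong) (auto simp: op_inner_cscale_right)
  then show ?thesis
    using assms by (simp add: orthonormal_def)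
qed

text \<open>Both sides are linear in \<open>A\<close>, so it suffices to check the vectors
  \<open>B j\<close>, where orthonormality picks out one term.\<close>

lemma orthonormal_expansion:
  assumes "orthonormal I B" "A \<in> cvec.span (B ` I)"
  shows "A = (\<Sum>i\<in>I. op_inner (B i) A *\<^sub>C B i)"
  using assms(2)
proof (induction rule: cvec.span_induct)
  case base
  have "c *\<^sub>C A = (\<Sum>i\<in>I. op_inner (B i) (c *\<^sub>C A) *\<^sub>C B i)"
    if "A = (\<Sum>i\<in>I. op_inner (B i) A *\<^sub>C B i)" for c A
  proof -
    have "c *\<^sub>C A = c *\<^sub>C (\<Sum>i\<in>I. op_inner (B i) A *\<^sub>C B i)"
      by (rule arg_cong[OF that])
    also have "\<dots> = (\<Sum>i\<in>I. op_inner (B i) (c *\<^sub>C A) *\<^sub>C B i)"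
      by (simp only: op_inner_cscale_right cvec.scale_sum_right cvec.scale_scale)
    finally show ?thesis .
  qed
  then show ?case
    unfolding cvec.subspace_def
    by (auto simp: op_inner_add_right cvec.scale_left_distrib sum.distrib)
next
  case (step A)
  then obtain j where "j \<in> I" "A = B j" by auto
  moreover have "(\<Sum>i\<in>I. op_inner (B i) (B j) *\<^sub>C B i) = (\<Sum>i\<in>I. if i = j then B j else 0)"
    using assms(1) \<open>j \<in> I\<close> by (intro sum.cong) (auto simp: orthonormal_def)
  ultimately show ?case
    using assms(1) by (simp add: orthonormal_def)
qed

text \<open>Evaluates the definite description: the orthonormal expansion gives existence, and
  uniqueness holds because inner products with \<open>B i\<close> recover every coefficient.\<close>

lemma expansion_coeffs_eq:
  assumes "orthonormal I B" "A \<in> cvec.span (B ` I)"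
  shows "expansion_coeffs I B A = (\<lambda>i. if i \<in> I then op_inner (B i) A else 0)"
  unfolding expansion_coeffs_def
proof (rule the_equality)
  show "(\<forall>i. i \<notin> I \<longrightarrow> (if i \<in> I then op_inner (B i) A else 0) = 0) \<and>
      A = (\<Sum>i\<in>I. (if i \<in> I then op_inner (B i) A else 0) *\<^sub>C B i)"
    using orthonormal_expansion[OF assms] by simp
next
  fix c
  assume "(\<forall>i. i \<notin> I \<longrightarrow> c i = 0) \<and> A = (\<Sum>i\<in>I. c i *\<^sub>C B i)"
  then show "c = (\<lambda>i. if i \<in> I then op_inner (B i) A else 0)"
    using orthonormal_coeff[OF assms(1)] by fastforce
qed

lemma parseval:
  assumes "orthonormal I B"
  shows "Re (op_inner (\<Sum>i\<in>I. c i *\<^sub>C B i) (\<Sum>i\<in>I. c i *\<^sub>C B i)) = (\<Sum>i\<in>I. (cmod (c i))\<^sup>2)"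
proof -
  define X where "X = (\<Sum>i\<in>I. c i *\<^sub>C B i)"
  have "op_inner X X = (\<Sum>i\<in>I. c i * cnj (op_inner (B i) X))"
    by (subst (2) X_def)
      (simp add: op_inner_sum_right op_inner_cscale_right cnj_op_inner)
  also have "\<dots> = (\<Sum>i\<in>I. of_real ((cmod (c i))\<^sup>2))"
    using orthonormal_coeff[OF assms]
    by (intro sum.cong) (simp_all add: X_def complex_norm_square[symmetric])
  finally show ?thesis
    by (simp add: X_def)
qed

text \<open>The vector \<open>X\<close> in the proof is the orthogonal projection of
  \<open>A\<close> to the span of the family. As \<open>A - X\<close> is orthogonal to
  \<open>X\<close>, the two sides differ by the squared norm of \<open>A - X\<close>.\<close>

lemma bessel:
  assumes "orthonormal I B"
  shows "(\<Sum>i\<in>I. (cmod (op_inner (B i) A))\<^sup>2) \<le> Re (op_inner A A)"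
proof -
  define X where "X = (\<Sum>i\<in>I. op_inner (B i) A *\<^sub>C B i)"
  have X: "op_inner (B i) X = op_inner (B i) A" if "i \<in> I" for i
    using orthonormal_coeff[OF assms that] by (simp add: X_def)
  have "op_inner (A - X) X = 0"
    by (subst (2) X_def)
      (simp add: op_inner_sum_right op_inner_cscale_right cnj_op_inner[of "B _" "A - X", symmetric]
        op_inner_diff_right X)
  then have "op_inner (A - X) (A - X) = op_inner (A - X) A"
    by (simp add: op_inner_diff_right)
  also have "\<dots> = cnj (op_inner A A - op_inner A X)"
    by (metis cnj_op_inner op_inner_diff_right)
  finally have 1: "Re (op_inner (A - X) (A - X)) = Re (op_inner A A) - Re (op_inner A X)"
    by simp
  have "op_inner X (A - X) = 0"
    using \<open>op_inner (A - X) X = 0\<close> by (metis cnj_op_inner complex_cnj_zero)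
  then have "op_inner X A = op_inner X X"
    by (simp add: op_inner_diff_right)
  then have "Re (op_inner A X) = Re (op_inner X X)"
    by (metis cnj_op_inner complex_cnj(1))
  also have "\<dots> = (\<Sum>i\<in>I. (cmod (op_inner (B i) A))\<^sup>2)"
    unfolding X_def by (rule parseval[OF assms])
  finally show ?thesis
    using 1 op_inner_self[of "A - X"] by simp (smt (verit) divide_nonneg_nonneg zero_le_power2 zero_le_power)
qed

section \<open>Comparison of first moments through tail sums\<close>

lemma sum_nat_weight_eq_tails:
  fixes d :: "'i \<Rightarrow> nat" and w :: "'i \<Rightarrow> real"
  assumes "finite I" "\<And>i. i \<in> I \<Longrightarrow> d i \<le> N"
  shows "(\<Sum>i\<in>I. real (d i) * w i) = (\<Sum>k<N. \<Sum>i\<in>{i\<in>I. k < d i}. w i)"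
proof -
  \<comment> \<open>The number \<open>d i\<close> counts the indices \<open>k < d i\<close>; the
    bound \<open>N\<close> gives all \<open>i\<close> the same finite range of
    \<open>k\<close>.\<close>
  have "real (d i) * w i = (\<Sum>k<N. if k < d i then w i else 0)" if "i \<in> I" for i
  proof -
    have "{..<N} \<inter> {k. k < d i} = {..<d i}" using assms(2)[OF that] by auto
    then show ?thesis by (simp add: sum.If_cases)
  qed
  then have "(\<Sum>i\<in>I. real (d i) * w i) = (\<Sum>k<N. \<Sum>i\<in>I. if k < d i then w i else 0)"
    by (simp add: sum.swap[of _ I])
  also have "\<dots> = (\<Sum>k<N. \<Sum>i\<in>{i\<in>I. k < d i}. w i)"
    by (simp add: sum.inter_filter[OF assms(1)])
  finally show ?thesis .
qed

text \<open>A vector \<open>P i\<close> with \<open>d i > k\<close> is orthogonal to every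
  \<open>B m\<close> with \<open>m \<le> k\<close>, so it sees only the tail \<open>R\<close> of
  \<open>A\<close> with indices above \<open>k\<close>. Bessel for \<open>P\<close> and Parseval for
  \<open>B\<close> compare the weights beyond each \<open>k\<close>; summing over \<open>k\<close>
  gives the moments.\<close>

lemma orthonormal_moment_le:
  fixes d :: "'i \<Rightarrow> nat"
  assumes P: "orthonormal I P" and B: "orthonormal {..<M} B"
    and orth: "\<And>i m. i \<in> I \<Longrightarrow> m < d i \<Longrightarrow> m < M \<Longrightarrow> op_inner (P i) (B m) = 0"
    and A: "A \<in> cvec.span (B ` {..<M})"
  shows "(\<Sum>i\<in>I. real (d i) * (cmod (op_inner (P i) A))\<^sup>2)
    \<le> (\<Sum>m<M. real m * (cmod (op_inner (B m) A))\<^sup>2)"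
proof -
  \<comment> \<open>Both moments are to be written over the same range \<open>k < N\<close>;
    inserting \<open>M\<close> also covers an empty \<open>I\<close>.\<close>
  define N where "N = Max (insert M (d ` I))"
  have fin: "finite I" using P by (simp add: orthonormal_def)
  have N: "M \<le> N" "\<And>i. i \<in> I \<Longrightarrow> d i \<le> N"
    unfolding N_def using fin by auto
  have tail: "(\<Sum>i\<in>{i\<in>I. k < d i}. (cmod (op_inner (P i) A))\<^sup>2)
      \<le> (\<Sum>m\<in>{m\<in>{..<M}. k < m}. (cmod (op_inner (B m) A))\<^sup>2)" for k
  proof -
    define J where "J = {m\<in>{..<M}. k < m}"
    define R where "R = (\<Sum>m\<in>J. op_inner (B m) A *\<^sub>C B m)"
    have J: "orthonormal J B" and I: "orthonormal {i\<in>I. k < d i} P"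
      by (auto simp: J_def intro: orthonormal_subset[OF B] orthonormal_subset[OF P])
    have "op_inner (P i) A = op_inner (P i) R" if "i \<in> I" "k < d i" for i
    proof -
      have "op_inner (P i) A = op_inner (P i) (\<Sum>m<M. op_inner (B m) A *\<^sub>C B m)"
        using orthonormal_expansion[OF B A] by simp
      also have "\<dots> = (\<Sum>m<M. op_inner (B m) A * op_inner (P i) (B m))"
        by (simp add: op_inner_sum_right op_inner_cscale_right)
      also have "\<dots> = (\<Sum>m\<in>J. op_inner (B m) A * op_inner (P i) (B m))"
      proof (rule sum.mono_neutral_right)
        show "\<forall>m\<in>{..<M} - J. op_inner (B m) A * op_inner (P i) (B m) = 0"
        proof
          fix m assume "m \<in> {..<M} - J"
          then have "m < d i" "m < M" using that(2) by (auto simp: J_def)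
          then show "op_inner (B m) A * op_inner (P i) (B m) = 0"
            using orth[OF that(1)] by simp
        qed
      qed (auto simp: J_def)
      finally show ?thesis
        by (simp add: R_def op_inner_sum_right op_inner_cscale_right)
    qed
    then have "(\<Sum>i\<in>{i\<in>I. k < d i}. (cmod (op_inner (P i) A))\<^sup>2)
        = (\<Sum>i\<in>{i\<in>I. k < d i}. (cmod (op_inner (P i) R))\<^sup>2)"
      by (intro sum.cong) auto
    also have "\<dots> \<le> Re (op_inner R R)"
      by (rule bessel[OF I])
    also have "\<dots> = (\<Sum>m\<in>J. (cmod (op_inner (B m) A))\<^sup>2)"
      unfolding R_def by (rule parseval[OF J])
    finally show ?thesis by (simp add: J_def)
  qed
  have "(\<Sum>i\<in>I. real (d i) * (cmod (op_inner (P i) A))\<^sup>2)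
      = (\<Sum>k<N. \<Sum>i\<in>{i\<in>I. k < d i}. (cmod (op_inner (P i) A))\<^sup>2)"
    by (rule sum_nat_weight_eq_tails[OF fin N(2)])
  also have "\<dots> \<le> (\<Sum>k<N. \<Sum>m\<in>{m\<in>{..<M}. k < m}. (cmod (op_inner (B m) A))\<^sup>2)"
    by (rule sum_mono) (rule tail)
  also have "\<dots> = (\<Sum>m<M. real m * (cmod (op_inner (B m) A))\<^sup>2)"
    by (rule sum_nat_weight_eq_tails[symmetric]) (use N(1) in auto)
  finally show ?thesis .
qed

section \<open>The Hadamard series\<close>

text \<open>The sum \<open>K\<close> of all entry moduli bounds every row sum, so each further
  factor \<open>A\<close> costs at most \<open>K\<close>.\<close>

lemma matpow_entry_bound:
  fixes A :: "'n::finite qop"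
  obtains K where "\<And>k x y. cmod (matpow A k $ x $ y) \<le> K ^ k"
proof -
  define K where "K = (\<Sum>x\<in>UNIV. \<Sum>y\<in>UNIV. cmod (A $ x $ y))"
  have row: "(\<Sum>y\<in>UNIV. cmod (A $ x $ y)) \<le> K" for x
    unfolding K_def
    by (rule member_le_sum[where f = "\<lambda>x. \<Sum>y\<in>UNIV. cmod (A $ x $ y)"]) (auto intro: sum_nonneg)
  have K: "0 \<le> K"
    unfolding K_def by (intro sum_nonneg) auto
  have "cmod (matpow A k $ x $ y) \<le> K ^ k" for k x y
  proof (induction k arbitrary: x)
    case 0
    show ?case by (simp add: mat_def)
  next
    case (Suc k)
    have "cmod (matpow A (Suc k) $ x $ y) \<le> (\<Sum>z\<in>UNIV. cmod (A $ x $ z) * cmod (matpow A k $ z $ y))"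
      by (simp add: matrix_matrix_mult_def norm_mult[symmetric] norm_sum)
    also have "\<dots> \<le> (\<Sum>z\<in>UNIV. cmod (A $ x $ z) * K ^ k)"
      by (intro sum_mono mult_left_mono Suc.IH) auto
    also have "\<dots> \<le> K * K ^ k"
      unfolding sum_distrib_right[symmetric] using row K by (intro mult_right_mono) auto
    finally show ?case by simp
  qed
  then show ?thesis by (rule that)
qed

lemma summable_matpow_entry:
  "summable (\<lambda>k. norm ((matpow A k /\<^sub>R fact k) $ x $ y))"
proof -
  obtain K where K: "\<And>k x y. cmod (matpow A k $ x $ y) \<le> K ^ k"
    using matpow_entry_bound by blast
  have "summable (\<lambda>k. inverse (fact k) * K ^ k)"
    by (rule summable_exp)
  then show ?thesis
    by (rule summable_comparison_test') (use K in \<open>auto simp: mult_left_mono\<close>)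
qed

text \<open>An infinite sum has its intended value only once convergence is known. For matrices
  convergence may be checked entrywise, where the exponential series of a real bound
  dominates.\<close>

lemma matexp_nth:
  "matexp A $ x $ y = (\<Sum>k. (matpow A k /\<^sub>R fact k) $ x $ y)"
proof -
  define E where "E = (\<chi> x y. \<Sum>k. (matpow A k /\<^sub>R fact k) $ x $ y)"
  have "(\<lambda>k. matpow A k /\<^sub>R fact k) sums E"
    unfolding sums_def
  proof (intro vec_tendstoI)
    fix x y
    have "(\<lambda>n. \<Sum>k<n. (matpow A k /\<^sub>R fact k) $ x $ y) \<longlonglongrightarrow> (\<Sum>k. (matpow A k /\<^sub>R fact k) $ x $ y)"
      by (rule summable_LIMSEQ[OF summable_norm_cancel[OF summable_matpow_entry]])
    then show "(\<lambda>n. (\<Sum>k<n. matpow A k /\<^sub>R fact k) $ x $ y) \<longlonglongrightarrow> E $ x $ y"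
      by (simp add: E_def)
  qed
  then show ?thesis
    by (simp add: matexp_def sums_iff E_def)
qed

lemma matpow_commute: "matpow A k ** A = A ** matpow A k"
  by (induction k) (simp_all add: matrix_mul_assoc[symmetric])

text \<open>This is the binomial expansion of the iterated commutator, arranged as the term of order
  \<open>n\<close> in the Cauchy product of the two exponentials around \<open>V\<close>. The sums
  \<open>D n\<close> satisfy \<open>(n + 1) D (n + 1) = commutator A (D n)\<close>, as the
  derivative in \<open>s\<close> of \<open>exp (s A) V exp (- s A)\<close> suggests.\<close>

lemma commutator_power_Cauchy:
  fixes A V :: "'n::finite qop"
  shows "(commutator A ^^ n) V /\<^sub>R fact n =
    (\<Sum>i\<le>n. (matpow A i /\<^sub>R fact i) ** V ** (matpow (- A) (n - i) /\<^sub>R fact (n - i)))"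
proof (induction n)
  case 0
  show ?case by simp
next
  case (Suc n)
  define e f where "e = (\<lambda>k. matpow A k /\<^sub>R fact k)" and "f = (\<lambda>k. matpow (- A) k /\<^sub>R fact k)"
  have e: "real (Suc k) *\<^sub>R e (Suc k) = A ** e k" for k
    by (simp add: e_def matrix_scalar_ac scalar_matrix_assoc[symmetric] del: of_nat_Suc)
  have f: "real (Suc k) *\<^sub>R f (Suc k) = - (f k ** A)" for k
  proof -
    have "real (Suc k) *\<^sub>R f (Suc k) = f k ** (- A)"
      by (simp add: f_def scalar_matrix_assoc[symmetric] matpow_commute del: of_nat_Suc)
    then show ?thesis
      by (simp add: matrix_minus_right)
  qed
  define D where "D = (\<lambda>n. \<Sum>i\<le>n. e i ** V ** f (n - i))"
  \<comment> \<open>Splitting the weight \<open>Suc n\<close> as \<open>i + (Suc n - i)\<close>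
    separates the terms: the first part lowers the index of \<open>e\<close>, the second that of
    \<open>f\<close>.\<close>
  have "real (Suc n) *\<^sub>R D (Suc n) = (\<Sum>i\<le>Suc n. (real i + real (Suc n - i)) *\<^sub>R (e i ** V ** f (Suc n - i)))"
    unfolding D_def scaleR_sum_right by (intro sum.cong) auto
  also have "\<dots> = (\<Sum>i\<le>Suc n. real i *\<^sub>R (e i ** V ** f (Suc n - i)))
      + (\<Sum>i\<le>Suc n. real (Suc n - i) *\<^sub>R (e i ** V ** f (Suc n - i)))"
    by (simp only: scaleR_left_distrib sum.distrib)
  also have "(\<Sum>i\<le>Suc n. real i *\<^sub>R (e i ** V ** f (Suc n - i)))
      = (\<Sum>i\<le>n. (real (Suc i) *\<^sub>R e (Suc i)) ** V ** f (n - i))"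
    by (subst sum.atMost_Suc_shift) (simp add: scalar_matrix_assoc del: of_nat_Suc)
  also have "\<dots> = A ** D n"
    by (simp add: e D_def matrix_sum_right matrix_mul_assoc del: of_nat_Suc)
  also have "(\<Sum>i\<le>Suc n. real (Suc n - i) *\<^sub>R (e i ** V ** f (Suc n - i)))
      = (\<Sum>i\<le>n. real (Suc n - i) *\<^sub>R (e i ** V ** f (Suc n - i)))"
    by simp
  also have "\<dots> = (\<Sum>i\<le>n. (e i ** V) ** (real (Suc (n - i)) *\<^sub>R f (Suc (n - i))))"
    by (intro sum.cong) (auto simp: matrix_scalar_ac scalar_matrix_assoc[symmetric] Suc_diff_le simp del: of_nat_Suc)
  also have "\<dots> = - (D n ** A)"
    unfolding f D_def
    by (simp add: matrix_minus_right matrix_sum_left matrix_mul_assoc sum_negf)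
  finally have "real (Suc n) *\<^sub>R D (Suc n) = commutator A (D n)"
    by (simp add: commutator_def)
  also have "D n = (commutator A ^^ n) V /\<^sub>R fact n"
    using Suc.IH by (simp add: D_def e_def f_def)
  also have "commutator A \<dots> = (commutator A ^^ Suc n) V /\<^sub>R fact n"
    by (simp add: scaleR_eq_cscale commutator_cscale)
  finally have "D (Suc n) = (commutator A ^^ Suc n) V /\<^sub>R fact (Suc n)"
    by (smt (verit) fact_Suc inverse_mult_distrib of_nat_fact of_nat_Suc scaleR_left_imp_eq scaleR_scaleR
        of_nat_eq_0_iff nat.distinct(1) divideR_right mult.commute)
  then show ?case
    by (simp only: D_def e_def f_def)
qed

text \<open>Each entry of the triple product is a finite combination of products of two absolutely
  convergent scalar series, to which the Cauchy product theorem applies.\<close>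

lemma conjugate_matexp_sums:
  fixes A V :: "'n::finite qop"
  shows "(\<lambda>n. (commutator A ^^ n) V /\<^sub>R fact n) sums (matexp A ** V ** matexp (- A))"
  unfolding sums_def
proof (intro vec_tendstoI, unfold sum_component)
  fix x y
  let ?e = "\<lambda>k. matpow A k /\<^sub>R fact k" and ?f = "\<lambda>k. matpow (- A) k /\<^sub>R fact k"
  have "(\<lambda>n. \<Sum>b\<in>UNIV. \<Sum>a\<in>UNIV. V $ a $ b * (\<Sum>i\<le>n. ?e i $ x $ a * ?f (n - i) $ b $ y)) sums
      (\<Sum>b\<in>UNIV. \<Sum>a\<in>UNIV. V $ a $ b * ((\<Sum>k. ?e k $ x $ a) * (\<Sum>k. ?f k $ b $ y)))"
    by (intro sums_sum sums_mult Cauchy_product_sums summable_matpow_entry)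
  also have "(\<Sum>b\<in>UNIV. \<Sum>a\<in>UNIV. V $ a $ b * ((\<Sum>k. ?e k $ x $ a) * (\<Sum>k. ?f k $ b $ y)))
      = (matexp A ** V ** matexp (- A)) $ x $ y"
    by (simp add: matrix_matrix_mult_def matexp_nth sum_distrib_right sum_distrib_left mult_ac)
  also have "(\<lambda>n. \<Sum>b\<in>UNIV. \<Sum>a\<in>UNIV. V $ a $ b * (\<Sum>i\<le>n. ?e i $ x $ a * ?f (n - i) $ b $ y))
      = (\<lambda>n. ((commutator A ^^ n) V /\<^sub>R fact n) $ x $ y)"
  proof
    fix n
    have "((commutator A ^^ n) V /\<^sub>R fact n) $ x $ y
        = (\<Sum>i\<le>n. \<Sum>b\<in>UNIV. \<Sum>a\<in>UNIV. ?e i $ x $ a * V $ a $ b * ?f (n - i) $ b $ y)"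
      unfolding commutator_power_Cauchy
      by (simp add: matrix_matrix_mult_def sum_distrib_right sum_distrib_left scaleR_sum_right)
    also have "\<dots> = (\<Sum>b\<in>UNIV. \<Sum>a\<in>UNIV. \<Sum>i\<le>n. ?e i $ x $ a * V $ a $ b * ?f (n - i) $ b $ y)"
      by (simp only: sum.swap[of _ "{..n}"])
    finally show "(\<Sum>b\<in>UNIV. \<Sum>a\<in>UNIV. V $ a $ b * (\<Sum>i\<le>n. ?e i $ x $ a * ?f (n - i) $ b $ y))
        = ((commutator A ^^ n) V /\<^sub>R fact n) $ x $ y"
      by (simp add: sum_distrib_left mult_ac)
  qed
  finally show "(\<lambda>n. \<Sum>i<n. ((commutator A ^^ i) V /\<^sub>R fact i) $ x $ y)
      \<longlonglongrightarrow> (matexp A ** V ** matexp (- A)) $ x $ y"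
    by (simp add: sums_def)
qed

lemma evolve_sums:
  "(\<lambda>n. ((\<i> * of_real t) ^ n / fact n) *\<^sub>C (commutator H ^^ n) V) sums evolve H t V"
proof -
  have "(commutator (z *\<^sub>C H) ^^ n) V = z ^ n *\<^sub>C (commutator H ^^ n) V" for z n
    by (induction n) (simp_all add: commutator_cscale_left commutator_cscale mult.commute)
  then show ?thesis
    using conjugate_matexp_sums[of "(\<i> * of_real t) *\<^sub>C H" V]
    by (simp add: evolve_def scaleR_eq_cscale divide_inverse mult.commute)
qed

text \<open>All partial sums of the Hadamard series lie in \<open>S\<close>, and \<open>S\<close> is
  closed.\<close>

lemma evolve_in_invariant_subspace:
  assumes S: "cvec.subspace S" and L: "\<And>A. A \<in> S \<Longrightarrow> commutator H A \<in> S" and V: "V \<in> S"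
  shows "evolve H t V \<in> S"
proof -
  have "(commutator H ^^ n) V \<in> S" for n
    by (induction n) (simp_all add: V L)
  then have "(\<Sum>k<n. ((\<i> * of_real t) ^ k / fact k) *\<^sub>C (commutator H ^^ k) V) \<in> S" for n
    by (intro cvec.subspace_sum[OF S] cvec.subspace_scale[OF S])
  then show ?thesis
    using evolve_sums[of t H V, unfolded sums_def]
    by (rule closed_sequentially[OF cvec_closed_subspace[OF S]])
qed

section \<open>The Krylov basis\<close>

text \<open>The recursion for \<open>krylov_O\<close> subtracts no diagonal term. With
  \<open>H\<close> and \<open>V\<close> Hermitian that term is zero, so the recursion is the Lanczos
  orthogonalization for \<open>commutator H\<close>.\<close>

locale krylov =
  fixes H V :: "'n::finite qop"
  assumes H: "adj H = H" and V: "adj V = V" and norm_V: "op_inner V V = 1"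
begin

abbreviation "b \<equiv> krylov_b H V"
abbreviation "X \<equiv> krylov_O H V"

lemma krylov_b_nonneg: "0 \<le> b m"
  by (cases m) (simp_all add: op_inner_self)

text \<open>Used to conclude that \<open>b (Suc m) = 0\<close> forces the unnormalized vector to
  vanish.\<close>

lemma krylov_A_norm: "norm (krylov_A H V (Suc m)) = b (Suc m) * sqrt (2 ^ CARD('n))"
  by (simp add: op_inner_self real_sqrt_divide)

text \<open>The degenerate cases fit as well: if \<open>b (Suc m) = 0\<close>, then
  \<open>krylov_A H V (Suc m)\<close> is zero; if \<open>m = 0\<close>, then
  \<open>X (m - 1)\<close> is \<open>X 0\<close>, but its coefficient \<open>b 0\<close> is
  zero.\<close>

lemma krylov_step:
  "commutator H (X m) = of_real (b (Suc m)) *\<^sub>C X (Suc m) + of_real (b m) *\<^sub>C X (m - 1)"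
proof -
  have "of_real (b (Suc m)) *\<^sub>C X (Suc m) = krylov_A H V (Suc m)"
  proof (cases "b (Suc m) = 0")
    case True
    then show ?thesis using krylov_A_norm[of m] by (simp del: krylov_b.simps)
  next
    case False
    then show ?thesis by (simp add: scaleR_eq_cscale[symmetric] del: krylov_b.simps)
  qed
  then show ?thesis
    by (cases m) (simp_all add: scaleR_eq_cscale del: krylov_b.simps(2) krylov_O.simps(2))
qed

lemma krylov_normalized:
  assumes "b (Suc m) \<noteq> 0"
  shows "op_inner (X (Suc m)) (X (Suc m)) = 1"
proof -
  have "norm (X (Suc m)) = sqrt (2 ^ CARD('n))"
    using assms krylov_A_norm[of m] krylov_b_nonneg[of "Suc m"]
    by (simp add: abs_of_nonneg del: krylov_b.simps)
  then show ?thesis by (simp add: op_inner_self del: krylov_O.simps)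
qed

text \<open>Alternately Hermitian and anti-Hermitian, so that the diagonal coefficients of the
  three-term recurrence vanish.\<close>

lemma adj_krylov: "adj (X m) = (- 1) ^ m *\<^sub>C X m"
proof (induction m rule: less_induct)
  case (less m)
  show ?case
  proof (cases m)
    case 0
    then show ?thesis by (simp add: V)
  next
    case (Suc k)
    \<comment> \<open>Taking adjoints reverses the commutator, which contributes one sign beyond
      that of \<open>X k\<close>.\<close>
    have comm: "adj (commutator H (X k)) = (- 1) ^ Suc k *\<^sub>C commutator H (X k)"
      using less.IH[of k] Suc
      by (simp add: adj_commutator H commutator_cscale_left)
        (simp add: commutator_def cscale_matrix_mul_left cscale_matrix_mul_right vec_eq_iff algebra_simps)
    have "adj (krylov_A H V m) = (- 1) ^ m *\<^sub>C krylov_A H V m"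
    proof (cases k)
      case 0
      then show ?thesis using comm Suc by simp
    next
      case (Suc j)
      \<comment> \<open>Since \<open>m = j + 2\<close>, the subtracted vector has the same adjoint
        sign as the commutator term.\<close>
      then have "adj (X j) = (- 1) ^ m *\<^sub>C X j"
        using less.IH[of j] \<open>m = Suc k\<close> by simp
      then show ?thesis
        using comm Suc \<open>m = Suc k\<close>
        by (simp add: adj_diff scaleR_eq_cscale adj_cscale cvec.scale_right_diff_distrib mult.commute
            del: krylov_b.simps krylov_O.simps power_Suc)
    qed
    then show ?thesis
      using Suc by (simp add: scaleR_eq_cscale adj_cscale mult.commute del: krylov_b.simps power_Suc)
  qed
qed

text \<open>By cyclicity the trace of \<open>X m ** commutator H (X m)\<close> vanishes, and
  \<open>X m\<close> equals its adjoint up to sign.\<close>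

lemma krylov_diagonal: "op_inner (X m) (commutator H (X m)) = 0"
proof -
  have "trace (X m ** (H ** X m)) = trace (X m ** (X m ** H))"
    by (metis matrix_mul_assoc trace_mul_sym)
  then have "op_inner (adj (X m)) (commutator H (X m)) = 0"
    by (simp add: op_inner_def commutator_def matrix_diff_ldistrib trace_sub adj_def)
  then show ?thesis
    by (simp add: adj_krylov op_inner_cscale_left)
qed

text \<open>The Lanczos argument: self-adjointness moves \<open>commutator H\<close> from
  \<open>X l\<close> to \<open>X j\<close>, and the recurrence for \<open>X j\<close> shows that the
  subtracted term cancels all overlap, leaving \<open>b k\<close> times the desired inner product
  equal to zero.\<close>

lemma krylov_orthogonal:
  assumes "\<And>m. 1 \<le> m \<Longrightarrow> m \<le> n \<Longrightarrow> b m \<noteq> 0" and "j < k" and "k \<le> n"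
  shows "op_inner (X j) (X k) = 0"
  using assms(2,3)
proof (induction k arbitrary: j rule: less_induct)
  case (less k)
  then obtain l where k: "k = Suc l" by (cases k) auto
  have orth: "op_inner (X i) (X j) = 0" if "i \<noteq> j" "i \<le> l" "j \<le> l" for i j
  proof (cases "i < j")
    case True
    then show ?thesis using less.IH[of j i] that less.prems k by simp
  next
    case False
    then have "op_inner (X j) (X i) = 0" using less.IH[of i j] that less.prems k by simp
    then show ?thesis by (metis cnj_op_inner complex_cnj_zero)
  qed
  have nrm: "op_inner (X i) (X i) = 1" if "i \<le> l" for i
    using that krylov_normalized[of "i - 1"] assms(1)[of i] less.prems k norm_V
    by (cases i) (auto simp del: krylov_b.simps krylov_O.simps(2))
  have step: "op_inner (X j) (commutator H (X l)) =
      of_real (b k) * op_inner (X j) (X k) + of_real (b l) * op_inner (X j) (X (l - 1))"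
    by (simp add: krylov_step[of l] k op_inner_add_right op_inner_cscale_right
        del: krylov_b.simps krylov_O.simps)
  have "op_inner (X j) (commutator H (X l)) = of_real (b l) * op_inner (X j) (X (l - 1))"
  proof (cases "j = l")
    \<comment> \<open>For \<open>l = 0\<close> the index \<open>l - 1\<close> is again
      \<open>0\<close>, and the right-hand side vanishes because \<open>b 0 = 0\<close>.\<close>
    case True
    then show ?thesis
      using krylov_diagonal[of l] orth[of l "l - 1"] by (cases l) auto
  next
    case False
    then have j: "j < l" using less.prems k by simp
    have "op_inner (X j) (commutator H (X l)) = op_inner (commutator H (X j)) (X l)"
      by (rule op_inner_commutator[OF H])
    also have "\<dots> = of_real (b (Suc j)) * op_inner (X (Suc j)) (X l)"
      using orth[of "j - 1" l] j
      by (simp add: krylov_step[of j] cnj_op_inner[of "X l", symmetric] op_inner_add_right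
          op_inner_cscale_right del: krylov_b.simps krylov_O.simps)
    \<comment> \<open>If \<open>Suc j = l\<close>, both inner products are squared norms equal to
      one; for smaller \<open>j\<close> both vanish.\<close>
    also have "\<dots> = of_real (b l) * op_inner (X j) (X (l - 1))"
    proof (cases "Suc j = l")
      case True
      then show ?thesis using nrm[of l] nrm[of j] by auto
    next
      case False
      then show ?thesis using orth[of "Suc j" l] orth[of j "l - 1"] j by simp
    qed
    finally show ?thesis .
  qed
  then show ?case
    using step assms(1)[of k] less.prems k by simp
qed

text \<open>Otherwise the \<open>X m\<close> would form an infinite orthonormal, hence independent,
  family in a finite-dimensional space.\<close>

lemma krylov_terminates: "\<exists>m\<ge>1. b m = 0"
proof (rule ccontr)
  assume "\<not> ?thesis"
  then have nz: "b m \<noteq> 0" if "1 \<le> m" for m using that by auto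
  have nrm: "op_inner (X i) (X i) = 1" for i
    using krylov_normalized[of "i - 1"] nz[of i] norm_V
    by (cases i) (auto simp del: krylov_b.simps krylov_O.simps(2))
  have orth: "op_inner (X i) (X j) = 0" if "i \<noteq> j" for i j
    using krylov_orthogonal[of j i j] krylov_orthogonal[of i j i] nz that
    by (metis cnj_op_inner complex_cnj_zero linorder_neqE_nat order_refl)
  have inj: "inj X"
    by (metis injI nrm orth zero_neq_one)
  have "pairwise orthogonal (range X)"
    unfolding pairwise_def orthogonal_def
  proof (intro ballI impI)
    fix A B assume "A \<in> range X" "B \<in> range X" "A \<noteq> B"
    then obtain i j where "A = X i" "B = X j" "i \<noteq> j" by blast
    then have "op_inner A B = 0" using orth by blast
    then show "inner A B = 0" using Re_op_inner[of A B] by simp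
  qed
  moreover have "0 \<notin> range X"
    using nrm by (metis imageE op_inner_zero_left zero_neq_one)
  ultimately have "independent (range X)"
    by (rule pairwise_orthogonal_independent)
  then have "finite (range X)"
    by (rule independent_imp_finite)
  then show False
    using inj by (simp add: finite_image_iff)
qed

abbreviation "M \<equiv> krylov_dim H V"

text \<open>Termination makes the least index exist, so \<open>krylov_dim\<close> has its defining
  property.\<close>

lemma krylov_dim: "1 \<le> M" "b M = 0" "\<And>m. 1 \<le> m \<Longrightarrow> m < M \<Longrightarrow> b m \<noteq> 0"
proof -
  have "1 \<le> M \<and> b M = 0"
    unfolding krylov_dim_def by (rule LeastI_ex) (use krylov_terminates in blast)
  then show "1 \<le> M" "b M = 0" by auto
  show "b m \<noteq> 0" if "1 \<le> m" "m < M" for m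
    using not_less_Least[of m "\<lambda>m. 1 \<le> m \<and> b m = 0"] that by (simp add: krylov_dim_def)
qed

text \<open>The phases have modulus one and are included so that the coefficients with respect to
  \<open>B\<close> are exactly those of \<open>krylov_phi\<close>.\<close>

definition B :: "nat \<Rightarrow> 'n qop"
  where "B m = \<i> ^ m *\<^sub>C X m"

lemma power_neg_ii_mult: "(- \<i>) ^ m * \<i> ^ m = 1" "\<i> ^ m * (- \<i>) ^ m = 1"
  by (simp_all flip: power_mult_distrib)

lemma krylov_orthonormal: "orthonormal {..<M} B"
proof -
  have nrm: "op_inner (X i) (X i) = 1" if "i < M" for i
    using that krylov_normalized[of "i - 1"] krylov_dim(3)[of i] norm_V
    by (cases i) (auto simp del: krylov_b.simps krylov_O.simps(2))
  have orth: "op_inner (X i) (X j) = 0" if "i < M" "j < M" "i \<noteq> j" for i j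
    using krylov_orthogonal[of j i j] krylov_orthogonal[of i j i] krylov_dim(3) that
    by (metis cnj_op_inner complex_cnj_zero linorder_neqE_nat order_refl order_le_less_trans)
  show ?thesis
    using nrm orth
    by (auto simp: orthonormal_def B_def op_inner_cscale_left op_inner_cscale_right
        power_neg_ii_mult mult.assoc[symmetric] simp del: krylov_O.simps)
qed

lemma krylov_in_span: "m < M \<Longrightarrow> X m \<in> cvec.span (B ` {..<M})"
proof -
  assume "m < M"
  then have "(- \<i>) ^ m *\<^sub>C B m \<in> cvec.span (B ` {..<M})"
    by (intro cvec.span_scale cvec.span_base) auto
  then show ?thesis
    by (simp add: B_def power_neg_ii_mult)
qed

text \<open>The three-term recurrence keeps the span of the Krylov basis invariant under
  \<open>commutator H\<close>.\<close>

lemma evolve_in_krylov_span: "evolve H t V \<in> cvec.span (B ` {..<M})"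
proof (rule evolve_in_invariant_subspace)
  show "V \<in> cvec.span (B ` {..<M})"
    using krylov_in_span[of 0] krylov_dim(1) by simp
  have X: "commutator H (X m) \<in> cvec.span (B ` {..<M})" if "m < M" for m
  proof -
    have "of_real (b (Suc m)) *\<^sub>C X (Suc m) \<in> cvec.span (B ` {..<M})"
    \<comment> \<open>At the top index the recurrence would leave the basis, but its coefficient is
      \<open>b M = 0\<close>.\<close>
    proof (cases "Suc m = M")
      case True
      then show ?thesis using krylov_dim(2) by (simp add: cvec.span_zero del: krylov_b.simps)
    next
      case False
      then show ?thesis using that by (intro cvec.span_scale krylov_in_span) auto
    qed
    moreover have "of_real (b m) *\<^sub>C X (m - 1) \<in> cvec.span (B ` {..<M})"
      using that by (intro cvec.span_scale krylov_in_span) auto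
    ultimately show ?thesis
      unfolding krylov_step by (rule cvec.span_add)
  qed
  show "commutator H A \<in> cvec.span (B ` {..<M})" if "A \<in> cvec.span (B ` {..<M})" for A
    using that
  proof (induction rule: cvec.span_induct)
    case base
    show ?case
      unfolding cvec.subspace_def
      by (auto simp: commutator_add commutator_cscale cvec.span_add cvec.span_scale cvec.span_zero)
        (simp add: commutator_def matrix_matrix_mult_def zero_vec_def[symmetric] cvec.span_zero)
  next
    case (step A)
    then show ?case
      using X by (auto simp: B_def[of m for m] commutator_cscale intro!: cvec.span_scale)
  qed
qed (rule cvec.subspace_span)

lemma krylov_complexity_eq:
  "krylov_complexity H V t = (\<Sum>m<M. real m * (cmod (op_inner (B m) (evolve H t V)))\<^sup>2)"
  using expansion_coeffs_eq[OF krylov_orthonormal evolve_in_krylov_span]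
  by (simp add: krylov_complexity_def krylov_phi_def B_def[abs_def])

end

section \<open>Pauli strings and the commutator graph\<close>

text \<open>The product modulo phases, that is, the Klein four-group; the scalar is kept apart in
  \<open>pauli_phase\<close>.\<close>

fun pauli_mul :: "pauli \<Rightarrow> pauli \<Rightarrow> pauli"
  where
    "pauli_mul Pauli_I b = b"
  | "pauli_mul a Pauli_I = a"
  | "pauli_mul Pauli_X Pauli_X = Pauli_I"
  | "pauli_mul Pauli_X Pauli_Y = Pauli_Z"
  | "pauli_mul Pauli_X Pauli_Z = Pauli_Y"
  | "pauli_mul Pauli_Y Pauli_X = Pauli_Z"
  | "pauli_mul Pauli_Y Pauli_Y = Pauli_I"
  | "pauli_mul Pauli_Y Pauli_Z = Pauli_X"
  | "pauli_mul Pauli_Z Pauli_X = Pauli_Y"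
  | "pauli_mul Pauli_Z Pauli_Y = Pauli_X"
  | "pauli_mul Pauli_Z Pauli_Z = Pauli_I"

fun pauli_phase :: "pauli \<Rightarrow> pauli \<Rightarrow> complex"
  where
    "pauli_phase Pauli_X Pauli_Y = \<i>"
  | "pauli_phase Pauli_Y Pauli_Z = \<i>"
  | "pauli_phase Pauli_Z Pauli_X = \<i>"
  | "pauli_phase Pauli_Y Pauli_X = - \<i>"
  | "pauli_phase Pauli_Z Pauli_Y = - \<i>"
  | "pauli_phase Pauli_X Pauli_Z = - \<i>"
  | "pauli_phase _ _ = 1"

lemma sum_UNIV_2: "(\<Sum>x\<in>UNIV. f (x :: 2)) = f 1 + f 2"
  by (simp add: sum_2)

lemma pauli_matrix_mult:
  "(\<Sum>l\<in>UNIV. pauli_matrix a $ x $ l * pauli_matrix b $ l $ y)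
    = pauli_phase a b * pauli_matrix (pauli_mul a b) $ x $ y"
  using exhaust_2[of x] exhaust_2[of y]
  by (cases a; cases b) (auto simp: sum_UNIV_2)

lemma pauli_matrix_adj: "cnj (pauli_matrix a $ x $ y) = pauli_matrix a $ y $ x"
  using exhaust_2[of x] exhaust_2[of y] by (cases a) auto

lemma pauli_matrix_inner:
  "(\<Sum>x\<in>UNIV. \<Sum>y\<in>UNIV. cnj (pauli_matrix a $ x $ y) * pauli_matrix b $ x $ y)
    = (if a = b then 2 else 0)"
  by (cases a; cases b) (auto simp: sum_UNIV_2)

text \<open>The distributive law that factors sums over computational basis states into one-qubit
  sums.\<close>

lemma prod_sum_UNIV:
  fixes f :: "'a::finite \<Rightarrow> 'b::finite \<Rightarrow> 'c::comm_semiring_1"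
  shows "(\<Sum>x\<in>UNIV. \<Prod>k\<in>UNIV. f k (x k)) = (\<Prod>k\<in>UNIV. \<Sum>y\<in>UNIV. f k y)"
  using prod_sum_PiE[of UNIV "\<lambda>_. UNIV" f] by simp

lemma pauli_tensor_mult:
  "pauli_tensor s ** pauli_tensor s' =
    (\<Prod>k\<in>UNIV. pauli_phase (s k) (s' k)) *\<^sub>C pauli_tensor (\<lambda>k. pauli_mul (s k) (s' k))"
proof -
  have "(\<Sum>z\<in>UNIV. \<Prod>k\<in>UNIV. pauli_matrix (s k) $ x k $ z k * pauli_matrix (s' k) $ z k $ y k)
      = (\<Prod>k\<in>UNIV. pauli_phase (s k) (s' k) * pauli_matrix (pauli_mul (s k) (s' k)) $ x k $ y k)"
    for x y :: "'a \<Rightarrow> 2"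
    by (simp only: prod_sum_UNIV[of "\<lambda>k z. pauli_matrix (s k) $ x k $ z * pauli_matrix (s' k) $ z $ y k"]
        pauli_matrix_mult)
  then show ?thesis
    by (simp add: vec_eq_iff pauli_tensor_def matrix_matrix_mult_def prod.distrib)
qed

lemma adj_pauli_tensor: "adj (pauli_tensor s) = pauli_tensor s"
  by (simp add: vec_eq_iff pauli_tensor_def pauli_matrix_adj)

lemma op_inner_pauli_tensor:
  fixes s s' :: "'n::finite \<Rightarrow> pauli"
  shows "op_inner (pauli_tensor s) (pauli_tensor s') = (if s = s' then 1 else 0)"
proof -
  let ?f = "\<lambda>k x y. cnj (pauli_matrix (s k) $ x $ y) * pauli_matrix (s' k) $ x $ y"
  have "(\<Sum>x\<in>UNIV. \<Sum>y\<in>UNIV. \<Prod>k\<in>UNIV. ?f k (x k) (y k))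
      = (\<Prod>k\<in>(UNIV :: 'n set). \<Sum>x\<in>UNIV. \<Sum>y\<in>UNIV. ?f k x y)"
    by (simp only: prod_sum_UNIV[of "\<lambda>k. ?f k (x k)" for x :: "'n \<Rightarrow> 2"]
        prod_sum_UNIV[of "\<lambda>k x. \<Sum>y\<in>UNIV. ?f k x y"])
  also have "\<dots> = (if s = s' then 2 ^ CARD('n) else 0)"
    unfolding pauli_matrix_inner by (auto simp: fun_eq_iff)
  finally show ?thesis
    by (simp add: op_inner_eq_sum pauli_tensor_def prod.distrib split: if_splits)
qed

text \<open>The family is indexed by the operators themselves, so distinct labels must give distinct
  operators: equal ones would have inner product one instead of zero.\<close>

lemma pauli_strings_orthonormal: "orthonormal (pauli_strings :: 'n::finite qop set) (\<lambda>q. q)"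
proof -
  have "finite (UNIV :: pauli set)"
    by (rule finite_subset[of _ "{Pauli_I, Pauli_X, Pauli_Y, Pauli_Z}"]) (auto intro: pauli.exhaust)
  then have "finite (UNIV :: ('n \<Rightarrow> pauli) set)"
    by (simp add: finite_UNIV_fun)
  then show ?thesis
    by (auto simp: orthonormal_def pauli_strings_def op_inner_pauli_tensor)
      (metis op_inner_pauli_tensor zero_neq_one)
qed

lemma adj_pauli_strings: "q \<in> pauli_strings \<Longrightarrow> adj q = q"
  by (auto simp: pauli_strings_def adj_pauli_tensor)

text \<open>As \<open>pauli_mul\<close> is commutative, both products are multiples of the same
  string. The scalar \<open>z\<close> may be zero.\<close>

lemma commutator_pauli_strings:
  assumes "g \<in> pauli_strings" "p \<in> pauli_strings"
  obtains z q where "q \<in> pauli_strings" "commutator g p = z *\<^sub>C q"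
proof -
  obtain s s' where s: "g = pauli_tensor s" "p = pauli_tensor s'"
    using assms by (auto simp: pauli_strings_def)
  have "pauli_mul a b = pauli_mul b a" for a b
    by (cases a; cases b) auto
  then have "commutator g p = ((\<Prod>k\<in>UNIV. pauli_phase (s k) (s' k)) - (\<Prod>k\<in>UNIV. pauli_phase (s' k) (s k)))
      *\<^sub>C pauli_tensor (\<lambda>k. pauli_mul (s k) (s' k))"
    by (simp add: commutator_def s pauli_tensor_mult cvec.scale_left_diff_distrib)
  then show ?thesis
    by (rule that[rotated]) (simp add: pauli_strings_def)
qed

lemma adj_hamiltonian: "G \<subseteq> pauli_strings \<Longrightarrow> adj (hamiltonian G c) = hamiltonian G c"
  unfolding hamiltonian_def adj_sum
  by (intro sum.cong) (auto simp: scaleR_eq_cscale adj_cscale adj_pauli_strings)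

section \<open>Balls in the commutator graph\<close>

definition graph_ball :: "'n::finite qop set \<Rightarrow> 'n qop \<Rightarrow> nat \<Rightarrow> 'n qop set"
  where "graph_ball G p m = {q. \<exists>k\<le>m. (p, q) \<in> commutator_graph G ^^ k}"

lemma graph_ball_mono: "m \<le> n \<Longrightarrow> graph_ball G p m \<subseteq> graph_ball G p n"
  by (auto simp: graph_ball_def intro: order_trans)

lemma graph_ball_subset_component: "graph_ball G p m \<subseteq> component G p"
  by (auto simp: graph_ball_def component_def intro: relpow_imp_rtrancl)

lemma graph_dist_le: "q \<in> graph_ball G p m \<Longrightarrow> graph_dist G p q \<le> m"
  by (auto simp: graph_ball_def graph_dist_def intro: Least_le order_trans)

lemma component_subset: "p \<in> pauli_strings \<Longrightarrow> component G p \<subseteq> pauli_strings"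
proof
  fix q assume "p \<in> pauli_strings" "q \<in> component G p"
  then have "(p, q) \<in> (commutator_graph G)\<^sup>*" by (simp add: component_def)
  then show "q \<in> pauli_strings"
    using \<open>p \<in> pauli_strings\<close> by (cases rule: rtranclE) (auto simp: commutator_graph_def)
qed

lemma component_orthonormal: "p \<in> pauli_strings \<Longrightarrow> orthonormal (component G p) (\<lambda>q. q)"
  by (rule orthonormal_subset[OF pauli_strings_orthonormal component_subset])

text \<open>By linearity it suffices to treat one generator and one string of the ball; their
  commutator is zero or a nonzero multiple of a neighbour of that string.\<close>

lemma commutator_graph_ball_span:
  assumes G: "G \<subseteq> pauli_strings" and p: "p \<in> pauli_strings"
    and A: "A \<in> cvec.span (graph_ball G p m)"
  shows "commutator (hamiltonian G c) A \<in> cvec.span (graph_ball G p (Suc m))"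
  using A
proof (induction rule: cvec.span_induct)
  case base
  show ?case
    unfolding cvec.subspace_def
    by (auto simp: commutator_add commutator_cscale cvec.span_add cvec.span_scale)
      (simp add: commutator_def matrix_matrix_mult_def zero_vec_def[symmetric] cvec.span_zero)
next
  case (step q)
  then obtain k where k: "k \<le> m" "(p, q) \<in> commutator_graph G ^^ k"
    by (auto simp: graph_ball_def)
  have q: "q \<in> pauli_strings"
    using step graph_ball_subset_component component_subset[OF p] by blast
  have "commutator g q \<in> cvec.span (graph_ball G p (Suc m))" if g: "g \<in> G" for g
  proof -
    obtain z r where r: "r \<in> pauli_strings" "commutator g q = z *\<^sub>C r"
      by (rule commutator_pauli_strings[OF subsetD[OF G g] q])
    show ?thesis
    proof (cases "z = 0")
      case True
      then show ?thesis by (simp add: r cvec.span_zero)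
    next
      case False
      then have "(q, r) \<in> commutator_graph G"
        using r q g by (auto simp: commutator_graph_def)
      then have "(p, r) \<in> commutator_graph G ^^ Suc k"
        using k by (blast intro: relpow_Suc_I)
      then have "r \<in> graph_ball G p (Suc m)"
        using k(1) unfolding graph_ball_def by blast
      then show ?thesis
        by (simp add: r cvec.span_base cvec.span_scale)
    qed
  qed
  then show ?case
    by (simp add: hamiltonian_def commutator_sum_left scaleR_eq_cscale commutator_cscale_left
        cvec.span_sum cvec.span_scale)
qed

lemma krylov_hamiltonian:
  assumes "G \<subseteq> pauli_strings" "p \<in> pauli_strings"
  shows "krylov (hamiltonian G c) p"
  using assms pauli_strings_orthonormal
  by unfold_locales (auto simp: adj_hamiltonian adj_pauli_strings orthonormal_def)

text \<open>The commutator enlarges the radius by one, the subtracted vector lies in a smaller ball,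
  and normalization only rescales.\<close>

lemma krylov_in_ball_span:
  assumes G: "G \<subseteq> pauli_strings" and p: "p \<in> pauli_strings"
  shows "krylov_O (hamiltonian G c) p m \<in> cvec.span (graph_ball G p m)"
proof (induction m rule: less_induct)
  case (less m)
  show ?case
  proof (cases m)
    case 0
    then show ?thesis
      by (auto simp: graph_ball_def intro: cvec.span_base)
  next
    case (Suc k)
    have comm: "commutator (hamiltonian G c) (krylov_O (hamiltonian G c) p k) \<in> cvec.span (graph_ball G p m)"
      using commutator_graph_ball_span[OF G p less.IH[of k]] Suc by simp
    have "krylov_A (hamiltonian G c) p m \<in> cvec.span (graph_ball G p m)"
    proof (cases k)
      case 0
      then show ?thesis using comm Suc by simp
    next
      case (Suc j)
      have "krylov_O (hamiltonian G c) p j \<in> cvec.span (graph_ball G p m)"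
        using less.IH[of j] cvec.span_mono[OF graph_ball_mono[of j m G p]] Suc \<open>m = Suc k\<close> by auto
      then show ?thesis
        using comm Suc \<open>m = Suc k\<close>
        by (simp add: scaleR_eq_cscale cvec.span_diff cvec.span_scale
            del: krylov_b.simps krylov_O.simps)
    qed
    then show ?thesis
      using Suc by (simp add: scaleR_eq_cscale cvec.span_scale del: krylov_b.simps krylov_A.simps)
  qed
qed

lemma op_inner_span_zero:
  assumes "A \<in> cvec.span S" "\<And>B. B \<in> S \<Longrightarrow> op_inner q B = 0"
  shows "op_inner q A = 0"
  using assms(1)
proof (induction rule: cvec.span_induct)
  case base
  show ?case
    by (auto simp: cvec.subspace_def op_inner_add_right op_inner_cscale_right)
qed (use assms(2) in auto)

section \<open>Comparison of the two complexities\<close>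

lemma evolve_in_component_span:
  assumes G: "G \<subseteq> pauli_strings" and p: "p \<in> pauli_strings"
  shows "evolve (hamiltonian G c) t p \<in> cvec.span (component G p)"
proof -
  interpret krylov "hamiltonian G c" p by (rule krylov_hamiltonian[OF assms])
  have "B m \<in> cvec.span (component G p)" for m
    using krylov_in_ball_span[OF assms, of c m] cvec.span_mono[OF graph_ball_subset_component]
    unfolding B_def by (blast intro: cvec.span_scale)
  then have "cvec.span (B ` {..<M}) \<subseteq> cvec.span (component G p)"
    by (intro cvec.span_minimal cvec.subspace_span) auto
  then show ?thesis
    using evolve_in_krylov_span by blast
qed

lemma graph_complexity_eq:
  assumes "G \<subseteq> pauli_strings" "p \<in> pauli_strings"
  shows "graph_complexity G p (evolve (hamiltonian G c) t p) =
    (\<Sum>q\<in>component G p. real (graph_dist G p q) * (cmod (op_inner q (evolve (hamiltonian G c) t p)))\<^sup>2)"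
  using expansion_coeffs_eq[OF component_orthonormal[OF assms(2)], of "evolve (hamiltonian G c) t p" G]
    evolve_in_component_span[OF assms]
  by (simp add: graph_complexity_def)

text \<open>The moment comparison is applied to the strings of the component, weighted by distance.
  A string farther than \<open>m\<close> from \<open>p\<close> is orthogonal to \<open>B m\<close>,
  which lies in the span of the ball of radius \<open>m\<close>.\<close>

lemma graph_complexity_le_krylov_complexity:
  assumes G: "G \<subseteq> pauli_strings" and p: "p \<in> pauli_strings"
  shows "graph_complexity G p (evolve (hamiltonian G c) t p) \<le> krylov_complexity (hamiltonian G c) p t"
proof -
  interpret krylov "hamiltonian G c" p by (rule krylov_hamiltonian[OF assms])
  show ?thesis
    unfolding graph_complexity_eq[OF assms] krylov_complexity_eq
  proof (rule orthonormal_moment_le)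
    fix q m assume q: "q \<in> component G p" and m: "m < graph_dist G p q"
    have "op_inner q r = 0" if "r \<in> graph_ball G p m" for r
    proof -
      have "r \<noteq> q" using graph_dist_le[OF that] m by auto
      moreover have "r \<in> component G p" using that graph_ball_subset_component by blast
      ultimately show ?thesis
        using component_orthonormal[OF p, of G] q by (auto simp: orthonormal_def)
    qed
    then show "op_inner q (B m) = 0"
      using op_inner_span_zero[OF krylov_in_ball_span[OF assms]]
      by (simp add: B_def op_inner_cscale_right)
  qed (use component_orthonormal[OF p] krylov_orthonormal evolve_in_krylov_span in auto)
qed

section \<open>A rotation on a single qubit\<close>

lemma evolve_add: "evolve H t (A + B) = evolve H t A + evolve H t B"
  by (simp add: evolve_def matrix_add_ldistrib matrix_add_rdistrib)

lemma evolve_cscale: "evolve H t (z *\<^sub>C A) = z *\<^sub>C evolve H t A"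
  by (simp add: evolve_def cscale_matrix_mul_left cscale_matrix_mul_right)

lemma sums_cscale:
  assumes "f sums z"
  shows "(\<lambda>n. f n *\<^sub>C A) sums (z *\<^sub>C A)"
proof (rule bounded_linear.sums[OF _ assms])
  have "linear (\<lambda>z. z *\<^sub>C A)"
    by (rule linearI) (simp_all add: cvec.scale_left_distrib scaleR_eq_cscale scaleR_conv_of_real)
  then show "bounded_linear (\<lambda>z. z *\<^sub>C A)"
    by (simp add: linear_conv_bounded_linear)
qed

text \<open>On an eigenvector the Hadamard series collapses to a scalar exponential series.\<close>

lemma evolve_eigenvector:
  assumes "commutator H A = \<mu> *\<^sub>C A"
  shows "evolve H t A = exp (\<i> * of_real t * \<mu>) *\<^sub>C A"
proof -
  have "(commutator H ^^ n) A = \<mu> ^ n *\<^sub>C A" for n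
    by (induction n) (simp_all add: commutator_cscale assms mult.commute)
  then have "(\<lambda>n. ((\<i> * of_real t * \<mu>) ^ n /\<^sub>R fact n) *\<^sub>C A) sums evolve H t A"
    using evolve_sums[of t H A]
    by (simp add: scaleR_conv_of_real power_mult_distrib divide_inverse mult_ac)
  moreover have "(\<lambda>n. ((\<i> * of_real t * \<mu>) ^ n /\<^sub>R fact n) *\<^sub>C A) sums (exp (\<i> * of_real t * \<mu>) *\<^sub>C A)"
    by (intro sums_cscale exp_converges)
  ultimately show ?thesis
    by (rule sums_unique2)
qed

text \<open>Here \<open>undefined\<close> serves as an arbitrary but fixed qubit, so that the
  example exists for every number of qubits.\<close>

definition site_pauli :: "pauli \<Rightarrow> 'n::finite qop"
  where "site_pauli a = pauli_tensor (\<lambda>k. if k = undefined then a else Pauli_I)"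

lemma site_pauli_string: "site_pauli a \<in> pauli_strings"
  by (simp add: site_pauli_def pauli_strings_def)

lemma site_pauli_mult: "site_pauli a ** site_pauli b = pauli_phase a b *\<^sub>C site_pauli (pauli_mul a b)"
proof -
  have "pauli_phase (if k = undefined then a else Pauli_I) (if k = undefined then b else Pauli_I)
      = (if k = undefined then pauli_phase a b else 1)" for k :: 'a
    by simp
  moreover have "pauli_mul (if k = undefined then a else Pauli_I) (if k = undefined then b else Pauli_I)
      = (if k = undefined then pauli_mul a b else Pauli_I)" for k :: 'a
    by simp
  ultimately show ?thesis
    by (simp only: site_pauli_def pauli_tensor_mult prod.delta[OF finite_class.finite_UNIV] UNIV_I if_True)
qed

lemma op_inner_site_pauli: "op_inner (site_pauli a) (site_pauli b) = (if a = b then 1 else 0)"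
  by (auto simp: site_pauli_def op_inner_pauli_tensor fun_eq_iff)

lemma commutator_site_pauli:
  "commutator (site_pauli Pauli_Z) (site_pauli Pauli_X) = (2 * \<i>) *\<^sub>C site_pauli Pauli_Y"
  "commutator (site_pauli Pauli_Z) (site_pauli Pauli_Y) = (- 2 * \<i>) *\<^sub>C site_pauli Pauli_X"
  by (simp_all add: commutator_def site_pauli_mult vec_eq_iff)

text \<open>With \<open>X\<close>, \<open>Y\<close>, \<open>Z\<close> at the chosen site,
  \<open>X + i Y\<close> and \<open>X - i Y\<close> are eigenvectors of the commutator with
  \<open>Z\<close> for the eigenvalues \<open>2\<close> and \<open>-2\<close>. At time
  \<open>pi / 4\<close> their phases are \<open>i\<close> and \<open>-i\<close>.\<close>

lemma evolve_site_pauli: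
  "evolve (site_pauli Pauli_Z) (pi / 4) (site_pauli Pauli_X) = - 1 *\<^sub>C site_pauli Pauli_Y"
proof -
  let ?Z = "site_pauli Pauli_Z :: 'a qop" and ?X = "site_pauli Pauli_X :: 'a qop"
    and ?Y = "site_pauli Pauli_Y :: 'a qop"
  have plus: "commutator ?Z (?X + \<i> *\<^sub>C ?Y) = 2 *\<^sub>C (?X + \<i> *\<^sub>C ?Y)"
    by (simp only: commutator_add commutator_cscale commutator_site_pauli)
      (simp add: vec_eq_iff algebra_simps)
  have minus: "commutator ?Z (?X + (- \<i>) *\<^sub>C ?Y) = (- 2) *\<^sub>C (?X + (- \<i>) *\<^sub>C ?Y)"
    by (simp only: commutator_add commutator_cscale commutator_site_pauli)
      (simp add: vec_eq_iff algebra_simps)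
  have e: "exp (\<i> * of_real (pi / 4) * 2) = \<i>" "exp (\<i> * of_real (pi / 4) * (- 2)) = - \<i>"
    using cis_conv_exp[of "pi / 2"] cis_conv_exp[of "- (pi / 2)"] by (simp_all add: complex_eq_iff)
  have "?X = (1 / 2) *\<^sub>C (?X + \<i> *\<^sub>C ?Y) + (1 / 2) *\<^sub>C (?X + (- \<i>) *\<^sub>C ?Y)"
    by (simp add: vec_eq_iff algebra_simps)
  then have "evolve ?Z (pi / 4) ?X = evolve ?Z (pi / 4) ((1 / 2) *\<^sub>C (?X + \<i> *\<^sub>C ?Y) + (1 / 2) *\<^sub>C (?X + (- \<i>) *\<^sub>C ?Y))"
    by (rule arg_cong)
  also have "\<dots> = (1 / 2) *\<^sub>C \<i> *\<^sub>C (?X + \<i> *\<^sub>C ?Y) + (1 / 2) *\<^sub>C (- \<i>) *\<^sub>C (?X + (- \<i>) *\<^sub>C ?Y)"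
    by (simp only: evolve_add[of _ _ "(1 / 2) *\<^sub>C _"] evolve_cscale[of _ _ "1 / 2"]
        evolve_eigenvector[OF plus] evolve_eigenvector[OF minus] e)
  also have "\<dots> = - 1 *\<^sub>C ?Y"
    by (simp add: vec_eq_iff algebra_simps)
  finally show ?thesis .
qed

text \<open>Both complexities are \<open>1\<close>: the graph complexity is at least \<open>1\<close> because \<open>p\<^sub>t\<close> has moved
  completely to a neighbour of \<open>p\<close>, and the Krylov complexity is at most \<open>1\<close> because the Krylov
  space is two-dimensional.\<close>

lemma complexities_site_pauli:
  fixes Z X :: "'n::finite qop"
  defines "Z \<equiv> site_pauli Pauli_Z" and "X \<equiv> site_pauli Pauli_X"
  shows "1 \<le> graph_complexity {Z} X (evolve (hamiltonian {Z} (\<lambda>_. 1)) (pi / 4) X)"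
    and "krylov_complexity (hamiltonian {Z} (\<lambda>_. 1)) X (pi / 4) \<le> 1"
proof -
  define Y :: "'n qop" where "Y = site_pauli Pauli_Y"
  have ham: "hamiltonian {Z} (\<lambda>_. 1) = Z" by (simp add: hamiltonian_def)
  have paulis: "{Z} \<subseteq> pauli_strings" "X \<in> pauli_strings" "Y \<in> pauli_strings"
    by (simp_all add: Z_def X_def Y_def site_pauli_string)
  have comm: "commutator Z X = (2 * \<i>) *\<^sub>C Y" "commutator Z Y = (- 2 * \<i>) *\<^sub>C X"
    unfolding Z_def X_def Y_def by (rule commutator_site_pauli)+
  have ev: "evolve Z (pi / 4) X = - 1 *\<^sub>C Y"
    unfolding Z_def X_def Y_def by (rule evolve_site_pauli)
  have YY: "op_inner Y Y = 1" and XY: "op_inner X Y = 0"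
    by (simp_all add: X_def Y_def op_inner_site_pauli)
  have edge: "(X, Y) \<in> commutator_graph {Z}"
    using paulis comm(1) by (auto simp: commutator_graph_def intro!: exI[of _ "2 * \<i>"])
  then have Y: "Y \<in> component {Z} X"
    by (auto simp: component_def)
  have "(X, Y) \<in> commutator_graph {Z} ^^ graph_dist {Z} X Y"
    unfolding graph_dist_def by (rule LeastI[of _ 1]) (use edge in simp)
  \<comment> \<open>Distance zero would mean \<open>X = Y\<close>, contradicting the two inner
    products.\<close>
  then have "graph_dist {Z} X Y \<noteq> 0"
    using XY YY by (metis relpow_0_E zero_neq_one)
  then have "1 \<le> real (graph_dist {Z} X Y) * (cmod (op_inner Y (- 1 *\<^sub>C Y)))\<^sup>2"
    by (simp add: op_inner_cscale_right YY del: cvec.scale_minus_left)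
  also have "\<dots> \<le> (\<Sum>q\<in>component {Z} X. real (graph_dist {Z} X q) * (cmod (op_inner q (- 1 *\<^sub>C Y)))\<^sup>2)"
    using component_orthonormal[OF paulis(2), of "{Z}"] Y
    by (intro member_le_sum[where f = "\<lambda>q. real (graph_dist {Z} X q) * (cmod (op_inner q (- 1 *\<^sub>C Y)))\<^sup>2"])
      (auto simp: orthonormal_def)
  finally show "1 \<le> graph_complexity {Z} X (evolve (hamiltonian {Z} (\<lambda>_. 1)) (pi / 4) X)"
    using graph_complexity_eq[OF paulis(1,2), of "\<lambda>_. 1" "pi / 4", unfolded ham ev] by (simp only: ham ev)
  interpret krylov Z X
    using krylov_hamiltonian[OF paulis(1,2)] ham by metis
  have "krylov_b Z X (Suc 0) = 2"
    by (simp add: comm op_inner_cscale_left op_inner_cscale_right YY)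
  moreover from this have "krylov_O Z X (Suc 0) = \<i> *\<^sub>C Y"
    by (simp add: comm scaleR_eq_cscale del: krylov_b.simps)
  \<comment> \<open>The commutator of \<open>Z\<close> with \<open>i Y\<close> is
    \<open>2 X\<close>, which is exactly the subtracted term.\<close>
  ultimately have "krylov_A Z X (Suc (Suc 0)) = 0"
    by (simp add: commutator_cscale comm scaleR_eq_cscale del: krylov_b.simps krylov_O.simps(2))
      (simp add: vec_eq_iff algebra_simps)
  then have "krylov_b Z X 2 = 0"
    by (simp add: numeral_2_eq_2 del: krylov_A.simps)
  then have "M \<le> 2"
    unfolding krylov_dim_def by (intro Least_le) simp
  \<comment> \<open>Only \<open>m = 0\<close> and \<open>m = 1\<close> can occur, so every weight is
    at most one and Bessel bounds the total.\<close>
  then have "krylov_complexity Z X (pi / 4) \<le> (\<Sum>m<M. (cmod (op_inner (B m) (evolve Z (pi / 4) X)))\<^sup>2)"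
    unfolding krylov_complexity_eq by (intro sum_mono mult_left_le_one_le) auto
  also have "\<dots> \<le> Re (op_inner (- 1 *\<^sub>C Y) (- 1 *\<^sub>C Y))"
    unfolding ev by (rule bessel[OF krylov_orthonormal])
  also have "\<dots> = 1"
    by (simp only: op_inner_cscale_left op_inner_cscale_right YY) simp
  finally show "krylov_complexity (hamiltonian {Z} (\<lambda>_. 1)) X (pi / 4) \<le> 1"
    by (simp only: ham)
qed

theorem lemma9:
  shows "(\<forall>(G :: ('n::finite) qop set) (c :: 'n qop \<Rightarrow> real) (p :: 'n qop) (t :: real).
            G \<subseteq> pauli_strings \<and> p \<in> pauli_strings \<longrightarrow>
            graph_complexity G p (evolve (hamiltonian G c) t p)
              \<le> krylov_complexity (hamiltonian G c) p t) \<and>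
         (\<exists>(G :: 'n qop set) (c :: 'n qop \<Rightarrow> real) (p :: 'n qop) (t :: real).
            G \<subseteq> pauli_strings \<and> p \<in> pauli_strings \<and>
            graph_complexity G p (evolve (hamiltonian G c) t p)
              = krylov_complexity (hamiltonian G c) p t \<and>
            krylov_complexity (hamiltonian G c) p t > 0)"
proof (intro conjI allI impI)
  fix G :: "'n qop set" and c :: "'n qop \<Rightarrow> real" and p :: "'n qop" and t :: real
  assume "G \<subseteq> pauli_strings \<and> p \<in> pauli_strings"
  then show "graph_complexity G p (evolve (hamiltonian G c) t p) \<le> krylov_complexity (hamiltonian G c) p t"
    by (intro graph_complexity_le_krylov_complexity) auto
next
  let ?Z = "site_pauli Pauli_Z :: 'n qop" and ?X = "site_pauli Pauli_X :: 'n qop"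
  have "{?Z} \<subseteq> pauli_strings" "?X \<in> pauli_strings"
    by (simp_all add: site_pauli_string)
  \<comment> \<open>The general inequality closes the chain
    \<open>1 \<le> graph complexity \<le> Krylov complexity \<le> 1\<close>.\<close>
  with complexities_site_pauli[where 'n = 'n]
    graph_complexity_le_krylov_complexity[of "{?Z}" ?X "\<lambda>_. 1" "pi / 4"]
  show "\<exists>(G :: 'n qop set) c p t. G \<subseteq> pauli_strings \<and> p \<in> pauli_strings \<and>
      graph_complexity G p (evolve (hamiltonian G c) t p) = krylov_complexity (hamiltonian G c) p t \<and>
      krylov_complexity (hamiltonian G c) p t > 0"
    by (intro exI[of _ "{?Z}"] exI[of _ "\<lambda>_. 1"] exI[of _ ?X] exI[of _ "pi / 4"]) simp
qed

end
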